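(* Let $k$ and $N$ be integers with $2 \le k < N$, and let $g_1,\dots,g_N \ge 0$ and $h_1,\dots,h_N > 0$ be reals with $\sum_{i=1}^N g_i = \sum_{i=1}^N h_i = 1$. Suppose the score distribution is ideal, that is, $$\frac{g_1}{h_1} \le \frac{g_2}{h_2} \le \dots \le \frac{g_N}{h_N}.$$ Then for every $q \in \{1,\dots,k-1\}$, the $(N-1)\times(N-1)$ matrix $A$ with entries in $\mathbb{R}\cup\{-\infty\}$ given by $$A_{p,i} = \begin{cases} \mathrm{DP}_{\mathrm{KL}}[i-1][q-1] + d_{\mathrm{KL}}(i,p) & (i = 1,2,\dots,p) \\ -\infty & (i > p) \end{cases}$$ (rows $p = 1,\dots,N-1$, columns $i = 1,\dots,N-1$) is a totally monotone matrix.
   Context: For integers $1 \le i_l \le i_r \le N$, $$d_{\mathrm{KL}}(i_l,i_r) = \left(\sum_{i=i_l}^{i_r} g_i\right) \log_2\left(\frac{\sum_{i=i_l}^{i_r} g_i}{\sum_{i=i_l}^{i_r} h_i}\right),$$ with the convention $0\log_2 0 = 0$. The table $\mathrm{DP}_{\mathrm{KL}}[p][q] \in \mathbb{R}\cup\{-\infty\}$, for $p = 0,\dots,N-1$ and $q = 0,\dots,k-1$, is defined recursively by $$\mathrm{DP}_{\mathrm{KL}}[p][q] = \begin{cases} 0 & (p = 0 \text{ and } q = 0) \\ -\infty & (\text{exactly one of } p, q \text{ is } 0) \\ \max_{i=1,\dots,p}\bigl(\mathrm{DP}_{\mathrm{KL}}[i-1][q-1] + d_{\mathrm{KL}}(i,p)\bigr)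 & (\text{otherwise}), \end{cases}$$ where $-\infty + x = -\infty$ for real $x$. For an $n \times m$ matrix $B$ (entries in $\mathbb{R}\cup\{-\infty\}$) and a row index $i$, let $J(i)$ be the smallest column index $j$ such that $B_{i,j}$ is the maximum value in the $i$-th row of $B$. $B$ is a monotone matrix if $J(i) \le J(i')$ whenever $1 \le i < i' \le n$. $B$ is a totally monotone matrix if every submatrix of $B$ (obtained by selecting a subset of rows and a subset of columns, keeping their order) is monotone. Equivalently, for all $i<i'$ and $j<j'$, $B_{i,j} < B_{i,j'}$ implies $B_{i',j} < B_{i',j'}$. *)

theory Defs
  imports
    "HOL-Analysis.Analysis"
    "Jordan_Normal_Form.DL_Submatrix"
begin

text \<open>
  The sequences \<open>g\<close>, \<open>h\<close> are functions on \<open>nat\<close> of which only the values at \<open>1, \<dots>, N\<close> matter.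
  The convention \<open>0 log 0 = 0\<close> needs no case distinction, as \<open>0 * log 2 0 = 0\<close> on the reals.
\<close>

definition d_KL :: "(nat \<Rightarrow> real) \<Rightarrow> (nat \<Rightarrow> real) \<Rightarrow> nat \<Rightarrow> nat \<Rightarrow> real" where
  "d_KL g h l r = (\<Sum>i=l..r. g i) * log 2 ((\<Sum>i=l..r. g i) / (\<Sum>i=l..r. h i))"

definition ideal_scores :: "nat \<Rightarrow> (nat \<Rightarrow> real) \<Rightarrow> (nat \<Rightarrow> real) \<Rightarrow> bool" where
  "ideal_scores N g h \<longleftrightarrow> (\<forall>i\<in>{1..<N}. g i / h i \<le> g (Suc i) / h (Suc i))"

text \<open>
  The values lie in the reals extended by \<open>-\<infinity>\<close>; type \<open>ereal\<close> is used for them, and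
  \<open>DP_KL_not_PInfty\<close> and \<open>DP_matrix_not_PInfty\<close> below show that \<open>\<infinity>\<close> does not occur.
\<close>

fun DP_KL :: "(nat \<Rightarrow> real) \<Rightarrow> (nat \<Rightarrow> real) \<Rightarrow> nat \<Rightarrow> nat \<Rightarrow> ereal" where
  "DP_KL g h 0 0 = 0"
| "DP_KL g h 0 (Suc q) = -\<infinity>"
| "DP_KL g h (Suc p) 0 = -\<infinity>"
| "DP_KL g h (Suc p) (Suc q) =
     (MAX i\<in>{1..Suc p}. DP_KL g h (i - 1) q + ereal (d_KL g h i (Suc p)))"

definition DP_entry :: "(nat \<Rightarrow> real) \<Rightarrow> (nat \<Rightarrow> real) \<Rightarrow> nat \<Rightarrow> nat \<Rightarrow> nat \<Rightarrow> ereal" where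
  "DP_entry g h q p i =
     (if i \<le> p then DP_KL g h (i - 1) (q - 1) + ereal (d_KL g h i p) else -\<infinity>)"

text \<open>
  Matrix positions of type \<open>mat\<close> count from \<open>0\<close>, while rows \<open>p\<close> and columns \<open>i\<close> of
  \<open>DP_entry\<close> run over \<open>1, \<dots>, N - 1\<close>.
\<close>

definition DP_matrix :: "(nat \<Rightarrow> real) \<Rightarrow> (nat \<Rightarrow> real) \<Rightarrow> nat \<Rightarrow> nat \<Rightarrow> ereal mat" where
  "DP_matrix g h N q = mat (N - 1) (N - 1) (\<lambda>(a, b). DP_entry g h q (a + 1) (b + 1))"

definition row_argmax :: "'a::linorder mat \<Rightarrow> nat \<Rightarrow> nat" where
  "row_argmax B i =
     (LEAST j. j < dim_col B \<and> B $$ (i, j) = (MAX j'\<in>{..<dim_col B}. B $$ (i, j')))"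

definition monotone_mat :: "'a::linorder mat \<Rightarrow> bool" where
  "monotone_mat B \<longleftrightarrow>
     (\<forall>i i'. i < i' \<and> i' < dim_row B \<longrightarrow> row_argmax B i \<le> row_argmax B i')"

text \<open>Submatrices without columns are left out, since their rows have no maximum.\<close>

definition totally_monotone_mat :: "'a::linorder mat \<Rightarrow> bool" where
  "totally_monotone_mat B \<longleftrightarrow>
     (\<forall>I J. I \<subseteq> {..<dim_row B} \<and> I \<noteq> {} \<and> J \<subseteq> {..<dim_col B} \<and> J \<noteq> {}
        \<longrightarrow> monotone_mat (submatrix B I J))"

lemma DP_KL_not_PInfty: "DP_KL g h p q \<noteq> \<infinity>"
proof (induction g h p q rule: DP_KL.induct)
  case (4 g h p q)
  let ?f = "\<lambda>i. DP_KL g h (i - 1) q + ereal (d_KL g h i (Suc p))"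
  have "(MAX i\<in>{1..Suc p}. ?f i) \<in> ?f ` {1..Suc p}"
    by (rule Max_in) auto
  then obtain i where "i \<in> {1..Suc p}" and i: "(MAX i\<in>{1..Suc p}. ?f i) = ?f i"
    by (rule imageE)
  then have "DP_KL g h (i - 1) q \<noteq> \<infinity>"
    using 4 by blast
  then show ?case
    unfolding DP_KL.simps i by simp
qed simp_all

lemma DP_matrix_not_PInfty:
  assumes "a < N - 1" and "b < N - 1"
  shows "DP_matrix g h N q $$ (a, b) \<noteq> \<infinity>"
  using assms by (simp add: DP_matrix_def DP_entry_def DP_KL_not_PInfty)

end

theory Submission
  imports Defs
begin

text \<open>
  Total monotonicity follows from the quadrangle inequality
  \<open>d_KL i p' + d_KL i' p \<le> d_KL i p + d_KL i' p'\<close> for \<open>i < i' \<le> p < p'\<close>.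
  With \<open>\<phi> x = x * log 2 x\<close>, each of the four terms is the mass \<open>H\<close> of an interval times the
  value of \<open>\<phi>\<close> at its ratio \<open>G / H\<close>. Both sides have the same total \<open>H\<close> and the same total \<open>G\<close>,
  and ideal scores place the two ratios on the left between the two on the right. The inequality
  is then the convexity of \<open>\<phi>\<close>: on the left \<open>\<phi>\<close> lies below the chord through the two right-hand
  points, and chords have equal \<open>H\<close>-weighted sums on both sides.
\<close>

text \<open>The point 0 has to belong to the domain because the \<open>g\<close>-mass of an interval
  may vanish. The derivative does not exist there, so convexity is derived from supporting tangents
  at the mean \<open>z\<close>.\<close>

lemma convex_on_x_log_x:
  assumes "1 < b"
  shows "convex_on {0..} (\<lambda>x. x * log b x)"
proof (rule convex_onI)
  show "convex {0::real..}" by (rule convex_real_interval)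
  fix t x y :: real
  assume t: "0 < t" "t < 1" and xy: "x \<in> {0..}" "y \<in> {0..}"
  define z where "z = (1 - t) * x + t * y"
  have "z \<ge> 0" using t xy by (simp add: z_def)
  have "z * ln z \<le> (1 - t) * (x * ln x) + t * (y * ln y)"
  proof (cases "z = 0")
    case True
    then have "x = 0" "y = 0"
      using t xy by (auto simp: z_def add_nonneg_eq_0_iff)
    then show ?thesis using True by simp
  next
    case False
    then have z: "z > 0" using \<open>z \<ge> 0\<close> by simp
    \<comment> \<open>The left side is the tangent at \<open>z\<close> to the graph of
      \<open>w * ln w\<close>, whose slope there is \<open>ln z + 1\<close>.\<close>
    have tangent: "w * ln z + (w - z) \<le> w * ln w" if "w \<ge> 0" for w
    proof (cases "w = 0")
      case True
      then show ?thesis using z by simp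
    next
      case False
      then have w: "w > 0" using that by simp
      have "ln z - ln w \<le> z / w - 1"
        using ln_le_minus_one[of "z / w"] w z by (simp add: ln_div)
      then have "w * (ln z - ln w) \<le> w * (z / w - 1)"
        using w by (intro mult_left_mono) auto
      then show ?thesis using w by (simp add: algebra_simps)
    qed
    \<comment> \<open>The corrections \<open>x - z\<close> and \<open>y - z\<close> average to 0,
      since \<open>z\<close> is the weighted mean.\<close>
    have "z * ln z = (1 - t) * (x * ln z + (x - z)) + t * (y * ln z + (y - z))"
      by (simp add: z_def algebra_simps)
    also have "\<dots> \<le> (1 - t) * (x * ln x) + t * (y * ln y)"
      using t xy tangent by (intro add_mono mult_left_mono) auto
    finally show ?thesis .
  qed
  then have "z * ln z / ln b \<le> ((1 - t) * (x * ln x) + t * (y * ln y)) / ln b"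
    using assms by (intro divide_right_mono) auto
  then show "((1 - t) *\<^sub>R x + t *\<^sub>R y) * log b ((1 - t) *\<^sub>R x + t *\<^sub>R y)
      \<le> (1 - t) * (x * log b x) + t * (y * log b y)"
    by (simp add: z_def log_def add_divide_distrib)
qed

text \<open>A two-point weighted form of Karamata's inequality: an affine function has the same
  weighted sum on both sides, so comparison with the chord suffices.\<close>

lemma convex_on_two_point_spread:
  fixes f :: "real \<Rightarrow> real"
  assumes f: "convex_on {x..y} f"
    and uv: "u \<in> {x..y}" "v \<in> {x..y}"
    and nonneg: "0 \<le> a" "0 \<le> b"
    and mass: "a + b = c + d" and mean: "a * u + b * v = c * x + d * y"
  shows "a * f u + b * f v \<le> c * f x + d * f y"
proof (cases "x = y")
  case True
  then have "u = x" "v = x" using uv by auto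
  then show ?thesis using True mass by (metis distrib_right order_refl)
next
  case False
  define m where "m = (f y - f x) / (y - x)"
  have xy: "x < y" using False uv by auto
  have y: "f y = f x + m * (y - x)"
    using False by (simp add: m_def)
  have chord: "f w \<le> f x + m * (w - x)" if "w \<in> {x..y}" for w
    using convex_onD_Icc'[OF f that] by (simp add: m_def algebra_simps)
  have "a * f u + b * f v \<le> a * (f x + m * (u - x)) + b * (f x + m * (v - x))"
    using nonneg chord uv by (intro add_mono mult_left_mono) auto
  also have "\<dots> = (a + b) * (f x - m * x) + m * (a * u + b * v)"
    by (simp add: algebra_simps)
  also have "\<dots> = c * f x + d * f y"
    unfolding mass mean y by (simp add: algebra_simps)
  finally show ?thesis .
qed

text \<open>Indices 1 and 2 stand for the \<open>g\<close>-mass and \<open>h\<close>-mass of three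
  consecutive blocks \<open>a\<close>, \<open>b\<close>, \<open>c\<close>. The cross products say
  that the ratios increase from block to block.\<close>

lemma mult_log_divide_quadrangle:
  fixes a1 a2 b1 b2 c1 c2 :: real
  assumes nonneg: "0 \<le> a1" "0 \<le> b1" "0 \<le> c1" and pos: "0 < a2" "0 < b2" "0 < c2"
    and ab: "a1 * b2 \<le> b1 * a2" and ac: "a1 * c2 \<le> c1 * a2" and bc: "b1 * c2 \<le> c1 * b2"
  shows "(a1 + b1 + c1) * log 2 ((a1 + b1 + c1) / (a2 + b2 + c2)) + b1 * log 2 (b1 / b2)
    \<le> (a1 + b1) * log 2 ((a1 + b1) / (a2 + b2)) + (b1 + c1) * log 2 ((b1 + c1) / (b2 + c2))"
proof -
  define f where "f = (\<lambda>x::real. x * log 2 x)"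
  let ?x = "(a1 + b1) / (a2 + b2)" and ?y = "(b1 + c1) / (b2 + c2)"
  let ?u = "(a1 + b1 + c1) / (a2 + b2 + c2)" and ?v = "b1 / b2"
  have "0 \<le> ?x" using nonneg pos by simp
  then have convex: "convex_on {?x..?y} f"
    unfolding f_def by (intro convex_on_subset[OF convex_on_x_log_x]) auto
  \<comment> \<open>Mediant inequalities: appending a block of larger ratio raises the total ratio,
    and prepending one of smaller ratio lowers it.\<close>
  have "?u \<in> {?x..?y}" "?v \<in> {?x..?y}"
    using pos ab ac bc by (auto simp: divide_simps) (simp_all add: algebra_simps)
  with convex
  have "(a2 + b2 + c2) * f ?u + b2 * f ?v \<le> (a2 + b2) * f ?x + (b2 + c2) * f ?y"
    using pos by (rule_tac convex_on_two_point_spread) auto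
  then show ?thesis
    using pos by (simp add: f_def)
qed

lemma ideal_scores_cross_mono:
  assumes ideal: "ideal_scores N g h" and h: "\<And>i. i \<in> {1..N} \<Longrightarrow> 0 < h i"
    and "1 \<le> i" "i \<le> j" "j \<le> N"
  shows "g i * h j \<le> g j * h i"
proof -
  have "g i / h i \<le> g j / h j"
    using \<open>i \<le> j\<close> \<open>j \<le> N\<close>
  proof (induction j rule: dec_induct)
    case (step n)
    then have "g n / h n \<le> g (Suc n) / h (Suc n)"
      using ideal \<open>1 \<le> i\<close> by (auto simp: ideal_scores_def)
    then show ?case using step by simp
  qed simp
  then show ?thesis
    using h[of i] h[of j] assms by (simp add: divide_simps mult.commute)
qed

text \<open>In product form the comparison of ratios is bilinear, so the pointwise inequalities can
  be summed over all pairs from \<open>I\<close> and \<open>J\<close>.\<close>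

lemma ideal_scores_sum_cross_mono:
  assumes "ideal_scores N g h" and "\<And>i. i \<in> {1..N} \<Longrightarrow> 0 < h i"
    and "I \<subseteq> {1..N}" "J \<subseteq> {1..N}" and "\<And>i j. i \<in> I \<Longrightarrow> j \<in> J \<Longrightarrow> i \<le> j"
  shows "sum g I * sum h J \<le> sum g J * sum h I"
proof -
  have "sum g I * sum h J \<le> (\<Sum>i\<in>I. \<Sum>j\<in>J. g j * h i)"
    unfolding sum_product using assms by (intro sum_mono ideal_scores_cross_mono) auto
  also have "\<dots> = sum g J * sum h I"
    unfolding sum_product by (rule sum.swap)
  finally show ?thesis .
qed

lemma d_KL_quadrangle:
  assumes ideal: "ideal_scores N g h"
    and g: "\<And>i. i \<in> {1..N} \<Longrightarrow> 0 \<le> g i" and h: "\<And>i. i \<in> {1..N} \<Longrightarrow> 0 < h i"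
    and order: "1 \<le> i" "i < i'" "i' \<le> p" "p < p'" "p' \<le> N"
  shows "d_KL g h i p' + d_KL g h i' p \<le> d_KL g h i p + d_KL g h i' p'"
proof -
  \<comment> \<open>The cuts before \<open>i'\<close> and after \<open>p\<close> express all four
    intervals by these blocks. The order assumptions make each block nonempty, hence of positive
    \<open>h\<close>-mass.\<close>
  let ?A = "{i..<i'}" and ?B = "{i'..p}" and ?C = "{p<..p'}"
  have split: "sum f {i..p} = sum f ?A + sum f ?B" "sum f {i'..p'} = sum f ?B + sum f ?C"
    "sum f {i..p'} = sum f ?A + sum f ?B + sum f ?C" for f :: "nat \<Rightarrow> real"
  proof -
    have sets: "{i..p} = ?A \<union> ?B" "{i'..p'} = ?B \<union> ?C" "{i..p'} = (?A \<union> ?B) \<union> ?C"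
      using order by auto
    show "sum f {i..p} = sum f ?A + sum f ?B"
      unfolding sets using order by (intro sum.union_disjoint) auto
    show "sum f {i'..p'} = sum f ?B + sum f ?C"
      unfolding sets using order by (intro sum.union_disjoint) auto
    have "sum f {i..p'} = sum f (?A \<union> ?B) + sum f ?C"
      unfolding sets using order by (intro sum.union_disjoint) auto
    also have "sum f (?A \<union> ?B) = sum f ?A + sum f ?B"
      using order by (intro sum.union_disjoint) auto
    finally show "sum f {i..p'} = sum f ?A + sum f ?B + sum f ?C" .
  qed
  show ?thesis
    unfolding d_KL_def split
  proof (rule mult_log_divide_quadrangle)
    show "0 \<le> sum g ?A" "0 \<le> sum g ?B" "0 \<le> sum g ?C"
      using order by (auto intro!: sum_nonneg g)
    show "0 < sum h ?A" "0 < sum h ?B" "0 < sum h ?C"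
      using order by (auto intro!: sum_pos h)
    show "sum g ?A * sum h ?B \<le> sum g ?B * sum h ?A" "sum g ?A * sum h ?C \<le> sum g ?C * sum h ?A"
      "sum g ?B * sum h ?C \<le> sum g ?C * sum h ?B"
      using order by (auto intro!: ideal_scores_sum_cross_mono[OF ideal h])
  qed
qed

lemma row_argmax:
  assumes "0 < dim_col B"
  shows "row_argmax B i < dim_col B"
    and "j < dim_col B \<Longrightarrow> B $$ (i, j) \<le> B $$ (i, row_argmax B i)"
    and "j < row_argmax B i \<Longrightarrow> B $$ (i, j) < B $$ (i, row_argmax B i)"
proof -
  let ?M = "MAX j\<in>{..<dim_col B}. B $$ (i, j)"
  let ?P = "\<lambda>j. j < dim_col B \<and> B $$ (i, j) = ?M"
  have "?M \<in> (\<lambda>j. B $$ (i, j)) ` {..<dim_col B}"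
    using assms by (intro Max_in) auto
  then have "\<exists>j. ?P j" by force
  then have arg: "?P (row_argmax B i)"
    unfolding row_argmax_def by (rule LeastI_ex)
  have le: "B $$ (i, j) \<le> ?M" if "j < dim_col B" for j
    using that by (intro Max_ge) auto
  show "row_argmax B i < dim_col B" using arg ..
  show "B $$ (i, j) \<le> B $$ (i, row_argmax B i)" if "j < dim_col B"
    using le[OF that] arg by simp
  show "B $$ (i, j) < B $$ (i, row_argmax B i)" if "j < row_argmax B i"
  proof -
    have "\<not> ?P j"
      using that unfolding row_argmax_def by (rule not_less_Least)
    then show ?thesis
      using that arg le[of j] by (auto simp: order.strict_iff_order)
  qed
qed

text \<open>If the leftmost maximum moved left from row \<open>i\<close> to row \<open>i'\<close>,
  its two positions would increase strictly in row \<open>i\<close>. By \<open>step\<close> they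
  would do so in row \<open>i'\<close>, against maximality of the left one there.\<close>

lemma monotone_matI:
  fixes B :: "'a::linorder mat"
  assumes cols: "0 < dim_col B"
    and step: "\<And>i i' j j'. i < i' \<Longrightarrow> i' < dim_row B \<Longrightarrow> j < j' \<Longrightarrow> j' < dim_col B \<Longrightarrow>
      B $$ (i, j) < B $$ (i, j') \<Longrightarrow> B $$ (i', j) < B $$ (i', j')"
  shows "monotone_mat B"
  unfolding monotone_mat_def
proof (intro allI impI, elim conjE)
  fix i i' assume i: "i < i'" "i' < dim_row B"
  show "row_argmax B i \<le> row_argmax B i'"
  proof (rule ccontr)
    assume "\<not> ?thesis"
    then have less: "row_argmax B i' < row_argmax B i" by simp
    from step[OF i less] row_argmax(1)[OF cols] row_argmax(3)[OF cols less]
    have "B $$ (i', row_argmax B i') < B $$ (i', row_argmax B i)" by simp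
    with row_argmax(1,2)[OF cols] show False by (meson leD)
  qed
qed

text \<open>The condition on pairs of rows and columns is inherited by submatrices, because
  \<open>pick\<close> is strictly increasing.\<close>

lemma totally_monotone_matI:
  fixes B :: "'a::linorder mat"
  assumes step: "\<And>i i' j j'. i < i' \<Longrightarrow> i' < dim_row B \<Longrightarrow> j < j' \<Longrightarrow> j' < dim_col B \<Longrightarrow>
      B $$ (i, j) < B $$ (i, j') \<Longrightarrow> B $$ (i', j) < B $$ (i', j')"
  shows "totally_monotone_mat B"
  unfolding totally_monotone_mat_def
proof (intro allI impI, elim conjE)
  fix I J
  assume I: "I \<subseteq> {..<dim_row B}" "I \<noteq> {}" and J: "J \<subseteq> {..<dim_col B}" "J \<noteq> {}"
  have fin: "finite I" "finite J" using I J by (auto intro: finite_subset)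
  have sets: "{i. i < dim_row B \<and> i \<in> I} = I" "{j. j < dim_col B \<and> j \<in> J} = J"
    using I J by auto
  have dim: "dim_row (submatrix B I J) = card I" "dim_col (submatrix B I J) = card J"
    by (simp_all add: dim_submatrix sets)
  have index: "submatrix B I J $$ (i, j) = B $$ (pick I i, pick J j)"
    if "i < card I" "j < card J" for i j
    using that by (simp add: submatrix_index sets)
  show "monotone_mat (submatrix B I J)"
  proof (rule monotone_matI)
    show "0 < dim_col (submatrix B I J)"
      using J fin by (simp add: dim card_gt_0_iff)
    fix i i' j j'
    assume *: "i < i'" "i' < dim_row (submatrix B I J)" "j < j'" "j' < dim_col (submatrix B I J)"
      "submatrix B I J $$ (i, j) < submatrix B I J $$ (i, j')"
    have "pick I i < pick I i'" "pick J j < pick J j'"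
      using * by (auto simp: dim intro: pick_mono)
    moreover have "pick I i' \<in> I" "pick J j' \<in> J"
      using * by (auto simp: dim intro: pick_in_set)
    ultimately show "submatrix B I J $$ (i', j) < submatrix B I J $$ (i', j')"
      using * I J step[of "pick I i" "pick I i'" "pick J j" "pick J j'"]
      by (auto simp: index dim)
  qed
qed

text \<open>The \<open>DP_KL\<close> summand of a column is the same in both rows, so only the
  difference of the \<open>d_KL\<close> terms changes, and the quadrangle inequality keeps it from
  shrinking.\<close>

lemma DP_entry_less_mono:
  assumes "ideal_scores N g h"
    and "\<And>i. i \<in> {1..N} \<Longrightarrow> 0 \<le> g i" and "\<And>i. i \<in> {1..N} \<Longrightarrow> 0 < h i"
    and order: "1 \<le> i" "i < i'" "p < p'" "p' \<le> N"
    and less: "DP_entry g h q p i < DP_entry g h q p i'"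
  shows "DP_entry g h q p' i < DP_entry g h q p' i'"
proof -
  \<comment> \<open>An entry right of the diagonal is \<open>-\<infinity>\<close> and cannot be
    strictly larger than another.\<close>
  have "i' \<le> p" using less by (auto simp: DP_entry_def split: if_splits)
  then have "d_KL g h i p' + d_KL g h i' p \<le> d_KL g h i p + d_KL g h i' p'"
    using assms by (intro d_KL_quadrangle) auto
  then show ?thesis
    using less order \<open>i' \<le> p\<close>
      DP_KL_not_PInfty[of g h "i - 1" "q - 1"] DP_KL_not_PInfty[of g h "i' - 1" "q - 1"]
    \<comment> \<open>By \<open>less\<close> the value for \<open>i'\<close> is finite. If the one
      for \<open>i\<close> is \<open>-\<infinity>\<close>, the claim is immediate; otherwise it is
      real arithmetic.\<close>
    by (cases "DP_KL g h (i - 1) (q - 1)"; cases "DP_KL g h (i' - 1) (q - 1)")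
      (auto simp: DP_entry_def)
qed

theorem theorem8:
  fixes k N :: nat and g h :: "nat \<Rightarrow> real"
  assumes "2 \<le> k" and "k < N"
    and "\<And>i. i \<in> {1..N} \<Longrightarrow> 0 \<le> g i"
    and "\<And>i. i \<in> {1..N} \<Longrightarrow> 0 < h i"
    and "(\<Sum>i=1..N. g i) = 1"
    and "(\<Sum>i=1..N. h i) = 1"
    and "ideal_scores N g h"
  shows "\<forall>q\<in>{1..k - 1}. totally_monotone_mat (DP_matrix g h N q)"
proof (intro ballI totally_monotone_matI)
  fix q i i' j j'
  assume "i < i'" "i' < dim_row (DP_matrix g h N q)" "j < j'" "j' < dim_col (DP_matrix g h N q)"
    and "DP_matrix g h N q $$ (i, j) < DP_matrix g h N q $$ (i, j')"
  then show "DP_matrix g h N q $$ (i', j) < DP_matrix g h N q $$ (i', j')"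
    \<comment> \<open>Positions shift from base 0 to base 1; the columns \<open>j\<close>,
      \<open>j'\<close> supply the left ends of intervals and the rows \<open>i\<close>,
      \<open>i'\<close> the right ends.\<close>
    using DP_entry_less_mono[OF assms(7,3,4), of "j + 1" "j' + 1" "i + 1" "i' + 1" q]
    by (simp add: DP_matrix_def)
qed

end
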